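(* Let $n\ge1$ and let $G=Q_{2^{n+2}}$ be the generalized quaternion group of order $2^{n+2}$, with generators $\sigma,\tau$ and relations $\sigma^{2^{n+1}}=1$, $\tau\sigma=\sigma^{-1}\tau$, $\tau^2=\sigma^{2^n}$. Let $G$ act by ring automorphisms on a ring $R$, let $U=\langle\sigma\rangle$, and let $x\in R$ satisfy $N_U(x)=1$. Set $$w=\sum_{k=1}^{2^{n+1}-1}(1+\sigma+\cdots+\sigma^{k-1})\bigl(x\cdot\sigma^{-k}(1-\sigma\tau)(x)\bigr),$$ $$a=(1+\sigma+\cdots+\sigma^{2^n-1})(x)+(1-\tau)(w).$$ Then $a$ is $U$-invariant, $N_{G/U}(a)=(1+\tau)(a)=1$, and $N_G(ax)=1$.
   Context: Rings are associative with unit, not necessarily commutative. For a finite group $V$ acting on $R$, $N_V(r)=\sum_{g\in V}g(r)$. The action of $G$ on $R$ is extended additively to an action of the group ring $\mathbf Z[G]$ on $R$, so that e.g. $(1-\sigma\tau)(x)=x-(\sigma\tau)(x)$. *)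

theory Defs
  imports "HOL-Algebra.Algebra" "HOL-Library.Poly_Mapping"
begin

(* Relations and generators alone would also allow proper quotients of the generalized
   quaternion group; the order excludes them. *)
definition generalized_quaternion ::
    "('g, 'm) monoid_scheme \<Rightarrow> nat \<Rightarrow> 'g \<Rightarrow> 'g \<Rightarrow> bool" where
  "generalized_quaternion G n \<sigma> \<tau> \<longleftrightarrow>
     group G \<and> \<sigma> \<in> carrier G \<and> \<tau> \<in> carrier G \<and>
     generate G {\<sigma>, \<tau>} = carrier G \<and>
     order G = 2 ^ (n + 2) \<and>
     \<sigma> [^]\<^bsub>G\<^esub> (2 ^ (n + 1) :: nat) = \<one>\<^bsub>G\<^esub> \<and>
     \<tau> \<otimes>\<^bsub>G\<^esub> \<sigma> = inv\<^bsub>G\<^esub> \<sigma> \<otimes>\<^bsub>G\<^esub> \<tau> \<and>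
     \<tau> [^]\<^bsub>G\<^esub> (2 :: nat) = \<sigma> [^]\<^bsub>G\<^esub> (2 ^ n :: nat)"

(* The library's group_action takes values in BijGroup (carrier R), so every map \<phi> g is
   additionally required to be extensional; this is only a normalization off carrier R. *)
locale ring_action = group_action G "carrier R" \<phi> + ring R
  for G :: "('g, 'm) monoid_scheme" and R :: "('r, 'k) ring_scheme"
    and \<phi> :: "'g \<Rightarrow> 'r \<Rightarrow> 'r" +
  assumes automorphism: "g \<in> carrier G \<Longrightarrow> \<phi> g \<in> ring_iso R R"

(* Elements of the group ring Z[G] are finitely supported functions 'g \<Rightarrow>\<^sub>0 int;
   frag_of g is the basis element g. *)
definition group_ring_act ::
    "('r, 'k) ring_scheme \<Rightarrow> ('g \<Rightarrow> 'r \<Rightarrow> 'r) \<Rightarrow> ('g \<Rightarrow>\<^sub>0 int) \<Rightarrow> 'r \<Rightarrow> 'r" where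
  "group_ring_act R \<phi> c r =
     (\<Oplus>\<^bsub>R\<^esub>g\<in>Poly_Mapping.keys c. [Poly_Mapping.lookup c g] \<cdot>\<^bsub>R\<^esub> \<phi> g r)"

definition act_norm ::
    "('r, 'k) ring_scheme \<Rightarrow> ('v \<Rightarrow> 'r \<Rightarrow> 'r) \<Rightarrow> 'v set \<Rightarrow> 'r \<Rightarrow> 'r" where
  "act_norm R \<phi> V r = (\<Oplus>\<^bsub>R\<^esub>g\<in>V. \<phi> g r)"

definition fixed_points ::
    "('r, 'k) ring_scheme \<Rightarrow> ('g \<Rightarrow> 'r \<Rightarrow> 'r) \<Rightarrow> 'g set \<Rightarrow> 'r set" where
  "fixed_points R \<phi> U = {r \<in> carrier R. \<forall>u\<in>U. \<phi> u r = r}"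

(* The induced action of a coset C on U-invariant elements: the common value of all
   representatives of C. It is meaningful only on fixed_points R \<phi> U. *)
definition quotient_act :: "('g \<Rightarrow> 'r \<Rightarrow> 'r) \<Rightarrow> 'g set \<Rightarrow> 'r \<Rightarrow> 'r" where
  "quotient_act \<phi> C r = the_elem ((\<lambda>g. \<phi> g r) ` C)"

lemma (in ring_action) quotient_act_coset:
  assumes "U \<lhd> G" "g \<in> carrier G" "r \<in> fixed_points R \<phi> U"
  shows "quotient_act \<phi> (U #>\<^bsub>G\<^esub> g) r = \<phi> g r"
proof -
  interpret U: normal U G by fact
  have U: "U \<subseteq> carrier G" by (rule U.subset)
  have r: "r \<in> carrier R" and fix_r: "\<And>u. u \<in> U \<Longrightarrow> \<phi> u r = r"
    using assms(3) by (auto simp: fixed_points_def)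
  have "\<phi> h r = \<phi> g r" if "h \<in> U #>\<^bsub>G\<^esub> g" for h
  proof -
    have "h \<in> g <#\<^bsub>G\<^esub> U" using that U.coset_eq assms(2) by blast
    then obtain u where u: "u \<in> U" "h = g \<otimes>\<^bsub>G\<^esub> u" by (auto simp: l_coset_def)
    then show ?thesis using composition_rule[OF r assms(2)] U fix_r by auto
  qed
  moreover have "g \<in> U #>\<^bsub>G\<^esub> g"
    by (rule U.rcos_self[OF assms(2) U.subgroup_axioms])
  ultimately have "(\<lambda>h. \<phi> h r) ` (U #>\<^bsub>G\<^esub> g) = {\<phi> g r}" by blast
  then show ?thesis by (simp add: quotient_act_def)
qed

end

(* With N_U(x) = 1 and y = (1 - \<sigma>\<tau>)(x) one has N_U(y) = 0, and applying 1 - \<sigma> to w telescopes each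
   inner sum, so that (\<sigma> - 1)w = y. Both \<sigma>a = a and (1 + \<tau>)a = 1 are then computations in
   Z[G]: the second reduces to the sum of the elements u\<tau> with u in U, applied to x, which is
   \<tau>(N_U(x)) = 1. Finally N_G(ax) = (1 + \<tau>)(a N_U(x)), as a is U-invariant. *)
theory Submission
  imports Defs
begin

text \<open>Origin of the formulas, with h = 2^n and S = 1 + \<sigma> + ... + \<sigma>^(h-1). The
  half norm S(x) alone is not \<sigma>-invariant: its defect is (\<sigma>^h - 1)(x). Since
  (\<sigma>\<tau>)^2 = \<tau>^2 = \<sigma>^h, this defect factors as -(1 + \<sigma>\<tau>)(y), which
  is why y is the element to be solved for: the term (1 - \<tau>)(w) in a is built to cancel it. The
  sum w is the explicit contraction for a cyclic group: an element of norm 1 turns every element of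
  norm 0 into a value of \<sigma> - 1. The correction changes (1 + \<tau>)(a) by (1 - \<tau>^2)(w) =
  (1 - \<sigma>^h)(w) = -S(y), which trades S(x) for S\<sigma>\<tau>(x); together with \<tau>S(x)
  this fills the coset U\<tau> exactly once. Two points shape the details. R need not be
  commutative, so in w the factor x stays on the left and the translate of y on the right. Norms are
  sums over sets of group elements, so passing to sums over exponents requires the powers of
  \<sigma> below 2^(n+1) to be distinct, and this has to be extracted from the order of G.\<close>

context ring
begin

lemma minus_add_cancel: "r \<in> carrier R \<Longrightarrow> s \<in> carrier R \<Longrightarrow> r \<ominus> s \<oplus> s = r"
  by (simp add: a_minus_def a_assoc l_neg)

lemma linear_cancel:
  "s \<in> carrier R \<Longrightarrow> h \<in> carrier R \<Longrightarrow> x \<in> carrier R \<Longrightarrow> w \<in> carrier R \<Longrightarrow> u \<in> carrier R \<Longrightarrow> t \<in> carrier R \<Longrightarrow>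
   s \<oplus> h \<ominus> x \<oplus> (w \<oplus> (x \<ominus> u) \<ominus> (t \<ominus> (u \<ominus> h))) = s \<oplus> (w \<ominus> t)"
  by algebra

lemma linear_cancel':
  "s \<in> carrier R \<Longrightarrow> w \<in> carrier R \<Longrightarrow> t \<in> carrier R \<Longrightarrow> p \<in> carrier R \<Longrightarrow> q \<in> carrier R \<Longrightarrow>
   s \<oplus> (w \<ominus> t) \<oplus> (p \<oplus> (t \<ominus> (s \<ominus> q \<oplus> w))) = p \<oplus> q"
  by algebra

end

section \<open>Actions by ring automorphisms: group ring, telescoping, norms\<close>

context ring_action
begin

lemma group_G: "group G"
  using group_hom group_hom.axioms(1) by blast

lemma act_hom: "g \<in> carrier G \<Longrightarrow> \<phi> g \<in> ring_hom R R"
  using automorphism by (simp add: ring_iso_def)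

lemma act_closed [simp]: "g \<in> carrier G \<Longrightarrow> r \<in> carrier R \<Longrightarrow> \<phi> g r \<in> carrier R"
  by (rule ring_hom_closed[OF act_hom])

lemma act_ring_hom_ring: "g \<in> carrier G \<Longrightarrow> ring_hom_ring R R (\<phi> g)"
  by (simp add: ring_hom_ringI2 act_hom ring_axioms)

lemma act_add: "g \<in> carrier G \<Longrightarrow> r \<in> carrier R \<Longrightarrow> s \<in> carrier R \<Longrightarrow> \<phi> g (r \<oplus>\<^bsub>R\<^esub> s) = \<phi> g r \<oplus>\<^bsub>R\<^esub> \<phi> g s"
  by (rule ring_hom_add[OF act_hom])

lemma act_one: "g \<in> carrier G \<Longrightarrow> \<phi> g \<one>\<^bsub>R\<^esub> = \<one>\<^bsub>R\<^esub>"
  by (rule ring_hom_one[OF act_hom])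

lemma act_act: "g \<in> carrier G \<Longrightarrow> h \<in> carrier G \<Longrightarrow> r \<in> carrier R \<Longrightarrow> \<phi> g (\<phi> h r) = \<phi> (g \<otimes>\<^bsub>G\<^esub> h) r"
  by (simp add: composition_rule)

lemma act_mult: "g \<in> carrier G \<Longrightarrow> r \<in> carrier R \<Longrightarrow> s \<in> carrier R \<Longrightarrow> \<phi> g (r \<otimes>\<^bsub>R\<^esub> s) = \<phi> g r \<otimes>\<^bsub>R\<^esub> \<phi> g s"
  by (rule ring_hom_mult[OF act_hom])

lemma act_id: "r \<in> carrier R \<Longrightarrow> \<phi> \<one>\<^bsub>G\<^esub> r = r"
  by (simp flip: id_eq_one)

lemma act_zero: "g \<in> carrier G \<Longrightarrow> \<phi> g \<zero>\<^bsub>R\<^esub> = \<zero>\<^bsub>R\<^esub>"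
  by (rule ring_hom_zero[OF act_hom ring_axioms ring_axioms])

lemma act_minus:
  assumes "g \<in> carrier G" "r \<in> carrier R" "s \<in> carrier R"
  shows "\<phi> g (r \<ominus>\<^bsub>R\<^esub> s) = \<phi> g r \<ominus>\<^bsub>R\<^esub> \<phi> g s"
proof -
  have "\<phi> g (r \<ominus>\<^bsub>R\<^esub> s) \<oplus>\<^bsub>R\<^esub> \<phi> g s = \<phi> g (r \<ominus>\<^bsub>R\<^esub> s \<oplus>\<^bsub>R\<^esub> s)"
    using assms by (simp add: act_add)
  also have "r \<ominus>\<^bsub>R\<^esub> s \<oplus>\<^bsub>R\<^esub> s = r"
    using assms by (simp add: minus_add_cancel)
  finally show ?thesis using assms by (metis act_closed add.inv_solve_right minus_closed a_minus_def)
qed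

lemma act_finsum:
  assumes g: "g \<in> carrier G" and f: "f \<in> A \<rightarrow> carrier R"
  shows "\<phi> g (\<Oplus>\<^bsub>R\<^esub>i\<in>A. f i) = (\<Oplus>\<^bsub>R\<^esub>i\<in>A. \<phi> g (f i))"
  using ring_hom_ring.hom_finsum[OF act_ring_hom_ring[OF g] f] by (simp add: comp_def)

text \<open>The support of a sum can be smaller than the union of the supports. Outside the support
  the coefficient is 0 and adds nothing, so two group ring elements can be compared over one common
  finite set.\<close>

lemma group_ring_act_superset:
  assumes "Poly_Mapping.keys c \<subseteq> S" "S \<subseteq> carrier G" "finite S" "r \<in> carrier R"
  shows "group_ring_act R \<phi> c r = (\<Oplus>\<^bsub>R\<^esub>g\<in>S. [Poly_Mapping.lookup c g] \<cdot>\<^bsub>R\<^esub> \<phi> g r)"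
  unfolding group_ring_act_def using assms
  by (intro add.finprod_mono_neutral_cong_left) (auto simp: in_keys_iff subset_iff add_pow_int_ge)

lemma group_ring_act_closed [simp]:
  assumes "Poly_Mapping.keys c \<subseteq> carrier G" "r \<in> carrier R"
  shows "group_ring_act R \<phi> c r \<in> carrier R"
  unfolding group_ring_act_def using assms by (intro finsum_closed) auto

lemma group_ring_act_add:
  assumes "Poly_Mapping.keys c \<subseteq> carrier G" "Poly_Mapping.keys d \<subseteq> carrier G" "r \<in> carrier R"
  shows "group_ring_act R \<phi> (c + d) r = group_ring_act R \<phi> c r \<oplus>\<^bsub>R\<^esub> group_ring_act R \<phi> d r"
proof -
  let ?S = "Poly_Mapping.keys c \<union> Poly_Mapping.keys d"
  have S: "?S \<subseteq> carrier G" "finite ?S" and keys: "Poly_Mapping.keys (c + d) \<subseteq> ?S"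
    using assms keys_add[of c d] by auto
  have "group_ring_act R \<phi> (c + d) r =
      (\<Oplus>\<^bsub>R\<^esub>g\<in>?S. [Poly_Mapping.lookup c g] \<cdot>\<^bsub>R\<^esub> \<phi> g r \<oplus>\<^bsub>R\<^esub> [Poly_Mapping.lookup d g] \<cdot>\<^bsub>R\<^esub> \<phi> g r)"
    unfolding group_ring_act_superset[OF keys S assms(3)]
    using assms S by (intro finsum_cong') (auto simp: lookup_add add.int_pow_mult)
  also have "\<dots> = (\<Oplus>\<^bsub>R\<^esub>g\<in>?S. [Poly_Mapping.lookup c g] \<cdot>\<^bsub>R\<^esub> \<phi> g r) \<oplus>\<^bsub>R\<^esub>
      (\<Oplus>\<^bsub>R\<^esub>g\<in>?S. [Poly_Mapping.lookup d g] \<cdot>\<^bsub>R\<^esub> \<phi> g r)"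
    using assms S by (intro finsum_addf) auto
  finally show ?thesis
    using assms S by (simp add: group_ring_act_superset[of _ ?S])
qed

lemma group_ring_act_frag_of:
  assumes "g \<in> carrier G" "r \<in> carrier R"
  shows "group_ring_act R \<phi> (frag_of g) r = \<phi> g r"
  using assms by (simp add: group_ring_act_def add.int_pow_1)

lemma group_ring_act_minus:
  assumes "Poly_Mapping.keys c \<subseteq> carrier G" "Poly_Mapping.keys d \<subseteq> carrier G" "r \<in> carrier R"
  shows "group_ring_act R \<phi> (c - d) r = group_ring_act R \<phi> c r \<ominus>\<^bsub>R\<^esub> group_ring_act R \<phi> d r"
proof -
  have k: "Poly_Mapping.keys (c - d) \<subseteq> carrier G"
    using assms keys_diff by fastforce
  have "group_ring_act R \<phi> c r = group_ring_act R \<phi> (c - d) r \<oplus>\<^bsub>R\<^esub> group_ring_act R \<phi> d r"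
    using group_ring_act_add[OF k assms(2,3)] by simp
  then show ?thesis using assms k by (simp add: a_minus_def a_assoc r_neg)
qed

lemma group_ring_act_sum:
  assumes "finite A" "\<And>i. i \<in> A \<Longrightarrow> Poly_Mapping.keys (c i) \<subseteq> carrier G" "r \<in> carrier R"
  shows "group_ring_act R \<phi> (\<Sum>i\<in>A. c i) r = (\<Oplus>\<^bsub>R\<^esub>i\<in>A. group_ring_act R \<phi> (c i) r)"
  using assms
proof (induction A rule: finite_induct)
  case empty
  then show ?case by (simp add: group_ring_act_def)
next
  case (insert i A)
  have "Poly_Mapping.keys (sum c A) \<subseteq> carrier G"
    using keys_sum[of c A] insert.prems by fastforce
  then show ?case using insert by (simp add: group_ring_act_add Pi_iff)
qed

lemma act_partial_sum_closed:
  assumes "g \<in> carrier G" "r \<in> carrier R"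
  shows "(\<Oplus>\<^bsub>R\<^esub>i\<in>{..<k::nat}. \<phi> (g [^]\<^bsub>G\<^esub> i) r) \<in> carrier R"
proof -
  interpret G: group G by (rule group_G)
  show ?thesis using assms by (intro finsum_closed) auto
qed

text \<open>This is (g - 1)(1 + g + ... + g^(k-1)) = g^k - 1, with the negative terms moved across
  so that the induction needs only commutativity and associativity of addition.\<close>

lemma act_partial_sum_telescope:
  assumes "g \<in> carrier G" "r \<in> carrier R"
  shows "\<phi> g (\<Oplus>\<^bsub>R\<^esub>i\<in>{..<k::nat}. \<phi> (g [^]\<^bsub>G\<^esub> i) r) \<oplus>\<^bsub>R\<^esub> r
    = (\<Oplus>\<^bsub>R\<^esub>i\<in>{..<k::nat}. \<phi> (g [^]\<^bsub>G\<^esub> i) r) \<oplus>\<^bsub>R\<^esub> \<phi> (g [^]\<^bsub>G\<^esub> k) r"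
proof (induction k)
  case 0
  then show ?case using assms by (simp add: act_zero act_id)
next
  case (Suc k)
  interpret G: group G by (rule group_G)
  let ?s = "\<Oplus>\<^bsub>R\<^esub>i\<in>{..<k::nat}. \<phi> (g [^]\<^bsub>G\<^esub> i) r"
  have s: "?s \<in> carrier R" using assms by (rule act_partial_sum_closed)
  have split: "(\<Oplus>\<^bsub>R\<^esub>i\<in>{..<Suc k}. \<phi> (g [^]\<^bsub>G\<^esub> i) r) = \<phi> (g [^]\<^bsub>G\<^esub> k) r \<oplus>\<^bsub>R\<^esub> ?s"
    using assms by (simp add: lessThan_Suc Pi_iff)
  have "\<phi> g (\<phi> (g [^]\<^bsub>G\<^esub> k) r) = \<phi> (g [^]\<^bsub>G\<^esub> Suc k) r"
    using assms by (metis G.nat_pow_Suc2 G.nat_pow_closed composition_rule)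
  then have "\<phi> g (\<phi> (g [^]\<^bsub>G\<^esub> k) r \<oplus>\<^bsub>R\<^esub> ?s) \<oplus>\<^bsub>R\<^esub> r = \<phi> (g [^]\<^bsub>G\<^esub> Suc k) r \<oplus>\<^bsub>R\<^esub> (\<phi> g ?s \<oplus>\<^bsub>R\<^esub> r)"
    using assms s by (simp only: act_add act_closed G.nat_pow_closed a_assoc)
  also have "\<dots> = \<phi> (g [^]\<^bsub>G\<^esub> k) r \<oplus>\<^bsub>R\<^esub> ?s \<oplus>\<^bsub>R\<^esub> \<phi> (g [^]\<^bsub>G\<^esub> Suc k) r"
    unfolding Suc.IH using assms s by (simp only: a_ac act_closed G.nat_pow_closed a_closed)
  finally show ?case unfolding split .
qed

lemma act_norm_closed:
  assumes "H \<subseteq> carrier G" "r \<in> carrier R" shows "act_norm R \<phi> H r \<in> carrier R"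
  unfolding act_norm_def using assms by (intro finsum_closed) auto

lemma act_norm_minus:
  assumes "H \<subseteq> carrier G" "r \<in> carrier R" "s \<in> carrier R"
  shows "act_norm R \<phi> H (r \<ominus>\<^bsub>R\<^esub> s) = act_norm R \<phi> H r \<ominus>\<^bsub>R\<^esub> act_norm R \<phi> H s"
proof -
  have "act_norm R \<phi> H r = (\<Oplus>\<^bsub>R\<^esub>h\<in>H. \<phi> h (r \<ominus>\<^bsub>R\<^esub> s) \<oplus>\<^bsub>R\<^esub> \<phi> h s)"
    unfolding act_norm_def using assms
    by (intro finsum_cong') (auto simp: subset_iff act_minus minus_add_cancel)
  also have "\<dots> = act_norm R \<phi> H (r \<ominus>\<^bsub>R\<^esub> s) \<oplus>\<^bsub>R\<^esub> act_norm R \<phi> H s"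
    unfolding act_norm_def using assms by (intro finsum_addf) auto
  finally have "act_norm R \<phi> H (r \<ominus>\<^bsub>R\<^esub> s) \<oplus>\<^bsub>R\<^esub> act_norm R \<phi> H s = act_norm R \<phi> H r" ..
  then have "act_norm R \<phi> H r \<ominus>\<^bsub>R\<^esub> act_norm R \<phi> H s
      = act_norm R \<phi> H (r \<ominus>\<^bsub>R\<^esub> s) \<oplus>\<^bsub>R\<^esub> act_norm R \<phi> H s \<ominus>\<^bsub>R\<^esub> act_norm R \<phi> H s" by simp
  then show ?thesis using assms by (simp add: act_norm_closed a_minus_def a_assoc r_neg)
qed

text \<open>Conjugation by \<open>g\<close> permutes \<open>H\<close>, and (g h g^-1) g = g h, so
  reindexing the sum by conjugates moves \<open>g\<close> to the outside.\<close>

lemma act_norm_normal: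
  assumes "H \<lhd> G" "g \<in> carrier G" "r \<in> carrier R"
  shows "act_norm R \<phi> H (\<phi> g r) = \<phi> g (act_norm R \<phi> H r)"
proof -
  interpret H: normal H G by fact
  have H: "\<And>h. h \<in> H \<Longrightarrow> h \<in> carrier G" by (rule H.mem_carrier)
  have inj: "inj_on (\<lambda>h. g \<otimes>\<^bsub>G\<^esub> h \<otimes>\<^bsub>G\<^esub> inv\<^bsub>G\<^esub> g) H"
    using assms H by (auto simp: inj_on_def)
  have img: "(\<lambda>h. g \<otimes>\<^bsub>G\<^esub> h \<otimes>\<^bsub>G\<^esub> inv\<^bsub>G\<^esub> g) ` H = H"
  proof safe
    fix h assume h: "h \<in> H"
    then show "g \<otimes>\<^bsub>G\<^esub> h \<otimes>\<^bsub>G\<^esub> inv\<^bsub>G\<^esub> g \<in> H" by (rule H.inv_op_closed2[OF assms(2)])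
    have "inv\<^bsub>G\<^esub> g \<otimes>\<^bsub>G\<^esub> h \<otimes>\<^bsub>G\<^esub> g \<in> H" using h by (rule H.inv_op_closed1[OF assms(2)])
    moreover have "h = g \<otimes>\<^bsub>G\<^esub> (inv\<^bsub>G\<^esub> g \<otimes>\<^bsub>G\<^esub> h \<otimes>\<^bsub>G\<^esub> g) \<otimes>\<^bsub>G\<^esub> inv\<^bsub>G\<^esub> g"
      using assms H[OF h] by (simp add: H.m_assoc H.m_assoc[symmetric, of g "inv\<^bsub>G\<^esub> g"])
    ultimately show "h \<in> (\<lambda>h. g \<otimes>\<^bsub>G\<^esub> h \<otimes>\<^bsub>G\<^esub> inv\<^bsub>G\<^esub> g) ` H" by blast
  qed
  have "act_norm R \<phi> H (\<phi> g r) = (\<Oplus>\<^bsub>R\<^esub>h\<in>H. \<phi> (g \<otimes>\<^bsub>G\<^esub> h \<otimes>\<^bsub>G\<^esub> inv\<^bsub>G\<^esub> g) (\<phi> g r))"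
    unfolding act_norm_def
    using assms H by (subst img[symmetric], subst add.finprod_reindex[OF _ inj]) (auto simp: img)
  also have "\<dots> = (\<Oplus>\<^bsub>R\<^esub>h\<in>H. \<phi> g (\<phi> h r))"
    using assms H
    by (intro finsum_cong') (auto simp: H.m_assoc simp flip: composition_rule)
  also have "\<dots> = \<phi> g (act_norm R \<phi> H r)"
    unfolding act_norm_def using assms H by (subst act_finsum) auto
  finally show ?thesis .
qed

end

section \<open>Normal forms and counting in the generalized quaternion group\<close>

locale generalized_quaternion_group = group G for G (structure) +
  fixes n :: nat and \<sigma> \<tau>
  assumes quaternion: "generalized_quaternion G n \<sigma> \<tau>"
begin

lemma sigma_closed [simp, intro]: "\<sigma> \<in> carrier G"
  and tau_closed [simp, intro]: "\<tau> \<in> carrier G"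
  and generate_sigma_tau: "generate G {\<sigma>, \<tau>} = carrier G"
  and order_G: "order G = 2 * 2 ^ (n + 1)"
  and sigma_pow_order: "\<sigma> [^] ((2::nat) ^ (n + 1)) = \<one>"
  and tau_sigma: "\<tau> \<otimes> \<sigma> = inv \<sigma> \<otimes> \<tau>"
  and tau_tau: "\<tau> \<otimes> \<tau> = \<sigma> [^] ((2::nat) ^ n)"
proof -
  have "\<tau> [^] (2::nat) = \<tau> \<otimes> \<tau>" if "\<tau> \<in> carrier G"
    using that by (simp add: numeral_2_eq_2)
  then show "\<sigma> \<in> carrier G" "\<tau> \<in> carrier G" "generate G {\<sigma>, \<tau>} = carrier G"
    "order G = 2 * 2 ^ (n + 1)" "\<sigma> [^] ((2::nat) ^ (n + 1)) = \<one>"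
    "\<tau> \<otimes> \<sigma> = inv \<sigma> \<otimes> \<tau>" "\<tau> \<otimes> \<tau> = \<sigma> [^] ((2::nat) ^ n)"
    using quaternion by (auto simp: generalized_quaternion_def)
qed

lemma tau_sigma_pow: "\<tau> \<otimes> \<sigma> [^] (i::nat) = inv (\<sigma> [^] i) \<otimes> \<tau>"
proof (induction i)
  case (Suc i)
  have "\<tau> \<otimes> \<sigma> [^] Suc i = (\<tau> \<otimes> \<sigma> [^] i) \<otimes> \<sigma>"
    by (simp add: m_assoc)
  also have "\<dots> = inv (\<sigma> [^] i) \<otimes> (\<tau> \<otimes> \<sigma>)"
    unfolding Suc.IH by (simp add: m_assoc)
  also have "\<dots> = inv (\<sigma> \<otimes> \<sigma> [^] i) \<otimes> \<tau>"
    unfolding tau_sigma by (simp add: m_assoc inv_mult_group)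
  also have "\<sigma> \<otimes> \<sigma> [^] i = \<sigma> [^] Suc i"
    by (metis nat_pow_Suc2 sigma_closed)
  finally show ?case .
qed simp

text \<open>Integer exponents allow words to be multiplied and inverted without reducing modulo
  2^(n+1); the reduction is done once, in \<open>sigma_int_pow_reduce\<close>.\<close>

lemma tau_sigma_int_pow: "\<tau> \<otimes> \<sigma> [^] (i::int) = \<sigma> [^] (- i) \<otimes> \<tau>"
proof (cases i rule: int_cases2)
  case (nonneg k)
  then show ?thesis by (simp add: int_pow_int int_pow_neg tau_sigma_pow)
next
  case (nonpos k)
  have "\<tau> = \<sigma> [^] k \<otimes> (\<tau> \<otimes> \<sigma> [^] k)"
    by (simp add: tau_sigma_pow m_assoc[symmetric])
  then have "\<tau> \<otimes> inv (\<sigma> [^] k) = \<sigma> [^] k \<otimes> \<tau>"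
    by (metis inv_solve_right' m_assoc nat_pow_closed m_closed sigma_closed tau_closed)
  with nonpos show ?thesis by (simp add: int_pow_int int_pow_neg)
qed

lemma sigma_int_pow_reduce: "\<sigma> [^] (i::int) \<in> (\<lambda>i. \<sigma> [^] i) ` {..<(2::nat) ^ (n + 1)}"
proof -
  let ?N = "(2::int) ^ (n + 1)"
  have "\<sigma> [^] i = \<sigma> [^] (?N * (i div ?N) + i mod ?N)"
    by (simp only: mult_div_mod_eq)
  also have "\<dots> = (\<sigma> [^] ?N) [^] (i div ?N) \<otimes> \<sigma> [^] (i mod ?N)"
    by (simp only: int_pow_mult int_pow_pow sigma_closed)
  also have "\<sigma> [^] ?N = \<one>"
    using sigma_pow_order int_pow_int[of G \<sigma> "2 ^ (n + 1)"] by simp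
  finally have "\<sigma> [^] i = \<sigma> [^] nat (i mod ?N)"
    by (simp flip: int_pow_int)
  moreover have "nat (i mod ?N) < 2 ^ (n + 1)"
    by (simp add: nat_less_iff)
  ultimately show ?thesis by blast
qed

lemma sigma_int_pow_tau_mult:
  "\<sigma> [^] (i::int) \<otimes> \<tau> \<otimes> \<sigma> [^] (j::int) = \<sigma> [^] (i - j) \<otimes> \<tau>"
  "\<sigma> [^] (i::int) \<otimes> \<tau> \<otimes> (\<sigma> [^] (j::int) \<otimes> \<tau>) = \<sigma> [^] (i - j + 2 ^ n)"
proof -
  show *: "\<sigma> [^] (i::int) \<otimes> \<tau> \<otimes> \<sigma> [^] (j::int) = \<sigma> [^] (i - j) \<otimes> \<tau>" for i j
    by (simp add: m_assoc tau_sigma_int_pow) (simp add: m_assoc[symmetric] flip: int_pow_mult)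
  have "\<sigma> [^] i \<otimes> \<tau> \<otimes> (\<sigma> [^] j \<otimes> \<tau>) = \<sigma> [^] i \<otimes> \<tau> \<otimes> \<sigma> [^] j \<otimes> \<tau>"
    by (simp add: m_assoc)
  also have "\<dots> = \<sigma> [^] (i - j) \<otimes> (\<tau> \<otimes> \<tau>)"
    by (simp add: * m_assoc)
  also have "\<dots> = \<sigma> [^] (i - j + 2 ^ n)"
    using tau_tau int_pow_int[of G \<sigma> "2 ^ n"] by (simp add: int_pow_mult)
  finally show "\<sigma> [^] i \<otimes> \<tau> \<otimes> (\<sigma> [^] j \<otimes> \<tau>) = \<sigma> [^] (i - j + 2 ^ n)" .
qed

text \<open>Moving each \<tau> to the right past powers of \<sigma>, and replacing \<tau>^2 by a
  power of \<sigma>, leaves at most one \<tau> in any word.\<close>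

lemma carrier_eq_int_pow: "carrier G = range (\<lambda>i::int. \<sigma> [^] i) \<union> range (\<lambda>i::int. \<sigma> [^] i \<otimes> \<tau>)"
    (is "_ = ?H")
proof
  have "g \<in> ?H" if "g \<in> generate G {\<sigma>, \<tau>}" for g
    using that
  proof induction
    case one
    show ?case using int_pow_0[of G \<sigma>] by (metis UnI1 rangeI)
  next
    case (incl h)
    moreover have "\<sigma> \<in> ?H" using int_pow_1[OF sigma_closed] by (metis UnI1 rangeI)
    moreover have "\<tau> = \<sigma> [^] (0::int) \<otimes> \<tau>" by simp
    then have "\<tau> \<in> ?H" by blast
    ultimately show ?case by blast
  next
    case (inv h)
    have "inv \<sigma> = \<sigma> [^] (-1::int)" by (simp add: int_pow_neg)
    then have "inv \<sigma> \<in> ?H" by blast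
    \<comment> \<open>The exponent is forced by \<tau>^2 = \<sigma>^(2^n), which makes the inverse
      of \<tau> a power of \<sigma> times \<tau>.\<close>
    moreover have "\<sigma> [^] (- (2 ^ n)::int) \<otimes> \<tau> \<otimes> \<tau> = \<one>"
      using sigma_int_pow_tau_mult(2)[of "- (2 ^ n)" 0] by simp
    then have "inv \<tau> = \<sigma> [^] (- (2 ^ n)::int) \<otimes> \<tau>"
      by (intro inv_equality) auto
    then have "inv \<tau> \<in> ?H" by blast
    ultimately show ?case using inv by blast
  next
    case (eng h1 h2)
    have "\<sigma> [^] (i::int) \<otimes> \<sigma> [^] (j::int) = \<sigma> [^] (i + j)"
      "\<sigma> [^] (i::int) \<otimes> (\<sigma> [^] (j::int) \<otimes> \<tau>) = \<sigma> [^] (i + j) \<otimes> \<tau>" for i j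
      by (simp_all add: int_pow_mult m_assoc)
    with eng.IH show ?case
      by (auto simp: sigma_int_pow_tau_mult)
  qed
  then show "carrier G \<subseteq> ?H" using generate_sigma_tau by blast
qed auto

lemma range_sigma_int_pow: "range (\<lambda>i::int. \<sigma> [^] i) = (\<lambda>i. \<sigma> [^] i) ` {..<(2::nat) ^ (n + 1)}"
proof
  show "(\<lambda>i. \<sigma> [^] i) ` {..<(2::nat) ^ (n + 1)} \<subseteq> range (\<lambda>i::int. \<sigma> [^] i)"
    by (metis image_subsetI int_pow_int rangeI)
  show "range (\<lambda>i::int. \<sigma> [^] i) \<subseteq> (\<lambda>i. \<sigma> [^] i) ` {..<(2::nat) ^ (n + 1)}"
    by (rule image_subsetI) (rule sigma_int_pow_reduce)
qed

lemma carrier_eq: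
  "carrier G = (\<lambda>i. \<sigma> [^] i) ` {..<(2::nat) ^ (n + 1)} \<union> (\<lambda>i. \<sigma> [^] i \<otimes> \<tau>) ` {..<(2::nat) ^ (n + 1)}"
proof -
  have "range (\<lambda>i::int. \<sigma> [^] i \<otimes> \<tau>) = (\<lambda>g. g \<otimes> \<tau>) ` range (\<lambda>i::int. \<sigma> [^] i)"
    by (simp add: image_image)
  then show ?thesis unfolding carrier_eq_int_pow range_sigma_int_pow by (simp add: image_image)
qed

lemma finite_carrier: "finite (carrier G)"
  by (subst carrier_eq) simp

text \<open>A counting argument: two images of a set with 2^(n+1) elements cover a group of order
  twice that size, so neither image can collapse and they cannot meet. This is where the order of
  \<open>G\<close> enters.\<close>

lemma inj_on_sigma_pow: "inj_on (\<lambda>i. \<sigma> [^] i) {..<(2::nat) ^ (n + 1)}" (is ?inj)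
  and sigma_tau_cosets_disjoint: "(\<lambda>i. \<sigma> [^] i) ` {..<(2::nat) ^ (n + 1)} \<inter> (\<lambda>i. \<sigma> [^] i \<otimes> \<tau>) ` {..<(2::nat) ^ (n + 1)} = {}"
    (is "?A \<inter> ?B = {}")
proof -
  have "card (?A \<union> ?B) = 2 * 2 ^ (n + 1)"
    using order_G by (simp only: order_def carrier_eq)
  moreover have "card (?A \<union> ?B) + card (?A \<inter> ?B) = card ?A + card ?B"
    by (rule card_Un_Int[symmetric]) simp_all
  moreover have "card ?A \<le> 2 ^ (n + 1)" "card ?B \<le> 2 ^ (n + 1)"
    by (rule card_image_le[THEN order_trans], simp, simp)+
  ultimately have "card ?A = 2 ^ (n + 1)" "card (?A \<inter> ?B) = 0"
    by linarith+
  then show ?inj "?A \<inter> ?B = {}"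
    by (simp only: eq_card_imp_inj_on card_lessThan finite_lessThan,
        metis card_0_eq finite_Int finite_imageI finite_lessThan)
qed

lemma generate_sigma: "generate G {\<sigma>} = (\<lambda>i. \<sigma> [^] i) ` {..<(2::nat) ^ (n + 1)}"
  by (simp only: range_sigma_int_pow[symmetric]) (auto simp: generate_pow)

text \<open>Splitting off one factor \<sigma> keeps the remaining exponent inside the range 0, ...,
  2^(n+1) - 1 even for \<open>i = 0\<close>, so that i -> 2^(n+1) - 1 - i reflects the index range
  onto itself.\<close>

lemma inv_sigma_pow: "i < 2 ^ (n + 1) \<Longrightarrow> inv (\<sigma> [^] i) = \<sigma> \<otimes> \<sigma> [^] (2 ^ (n + 1) - 1 - i :: nat)"
proof (rule inv_equality)
  assume i: "i < 2 ^ (n + 1)"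
  have "\<sigma> \<otimes> \<sigma> [^] (2 ^ (n + 1) - 1 - i) \<otimes> \<sigma> [^] i = \<sigma> \<otimes> \<sigma> [^] (2 ^ (n + 1) - 1 - i + i)"
    by (simp only: m_assoc nat_pow_mult nat_pow_closed sigma_closed)
  also have "\<dots> = \<sigma> [^] Suc (2 ^ (n + 1) - 1 - i + i)"
    by (simp only: nat_pow_Suc2 sigma_closed)
  also have "Suc (2 ^ (n + 1) - 1 - i + i) = 2 ^ (n + 1)"
    using i by linarith
  finally show "\<sigma> \<otimes> \<sigma> [^] (2 ^ (n + 1) - 1 - i) \<otimes> \<sigma> [^] i = \<one>"
    by (simp only: sigma_pow_order)
qed auto

lemma tau_notin: "\<tau> \<notin> generate G {\<sigma>}"
proof -
  have "\<sigma> [^] (0::nat) \<otimes> \<tau> \<in> (\<lambda>i. \<sigma> [^] i \<otimes> \<tau>) ` {..<(2::nat) ^ (n + 1)}"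
    by (rule imageI) simp
  then show ?thesis using sigma_tau_cosets_disjoint by (auto simp: generate_sigma)
qed

text \<open>Conjugation by a power of \<sigma> fixes \<sigma>^j, and conjugation by an element of
  the other coset inverts it.\<close>

lemma normal_generate_sigma: "generate G {\<sigma>} \<lhd> G"
proof (rule normal_invI)
  show "subgroup (generate G {\<sigma>}) G" by (simp add: generate_is_subgroup)
  fix g h assume g: "g \<in> carrier G" and "h \<in> generate G {\<sigma>}"
  then obtain j :: int where h: "h = \<sigma> [^] j" by (auto simp: generate_pow)
  consider i :: int where "g = \<sigma> [^] i" | i :: int where "g = \<sigma> [^] i \<otimes> \<tau>"
    using g carrier_eq_int_pow by blast
  then have "\<exists>k::int. g \<otimes> h = \<sigma> [^] k \<otimes> g"
  proof cases
    case (1 i)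
    then have "g \<otimes> h = \<sigma> [^] j \<otimes> g" unfolding h by (simp add: add.commute flip: int_pow_mult)
    then show ?thesis ..
  next
    case (2 i)
    then have "g \<otimes> h = \<sigma> [^] (-j) \<otimes> g" unfolding h
      by (simp add: sigma_int_pow_tau_mult add.commute m_assoc[symmetric] flip: int_pow_mult)
    then show ?thesis ..
  qed
  then obtain k :: int where "g \<otimes> h = \<sigma> [^] k \<otimes> g" ..
  then have "g \<otimes> h \<otimes> inv g = \<sigma> [^] k" using g by (simp add: m_assoc)
  then show "g \<otimes> h \<otimes> inv g \<in> generate G {\<sigma>}" by (auto simp: generate_pow)
qed

end

section \<open>Norms over U and the equation (\<sigma> - 1)(w) = y\<close>

locale quaternion_ring_action = G?: generalized_quaternion_group G n \<sigma> \<tau> + R?: ring_action G R \<phi>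
  for G (structure) and n :: nat and \<sigma> \<tau> and R :: "('r, 'k) ring_scheme" and \<phi>
begin

abbreviation U where "U \<equiv> generate G {\<sigma>}"

text \<open>With \<open>k = 2 ^ (n + 1)\<close> this is the norm over \<open>U\<close>; with
  \<open>k = 2 ^ n\<close> it is the half norm that occurs in a.\<close>

abbreviation partial_norm where
  "partial_norm k r \<equiv> \<Oplus>\<^bsub>R\<^esub>i\<in>{..<k::nat}. \<phi> (\<sigma> [^] i) r"

lemma U_subset: "U \<subseteq> carrier G"
  by (simp add: generate_incl)

lemma norm_U: "r \<in> carrier R \<Longrightarrow> act_norm R \<phi> U r = partial_norm (2 ^ (n + 1)) r"
  unfolding act_norm_def generate_sigma by (rule finsum_reindex[OF _ inj_on_sigma_pow]) auto

text \<open>Telescoping over a full period: the two boundary terms agree because \<sigma>^(2^(n+1))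
  = 1.\<close>

lemma act_sigma_norm_U:
  assumes r: "r \<in> carrier R"
  shows "\<phi> \<sigma> (act_norm R \<phi> U r) = act_norm R \<phi> U r"
proof -
  let ?N = "act_norm R \<phi> U r"
  have N: "?N \<in> carrier R" using r U_subset by (simp add: act_norm_closed)
  have "\<phi> \<sigma> ?N \<oplus>\<^bsub>R\<^esub> r = ?N \<oplus>\<^bsub>R\<^esub> r"
    using act_partial_sum_telescope[OF sigma_closed r, of "2 ^ (n + 1)"] r by (simp only: norm_U sigma_pow_order act_id)
  then show ?thesis
    by (rule R.add.right_cancel[THEN iffD1, rotated 3]) (use r N in simp_all)
qed

text \<open>Inversion permutes \<open>U\<close>. This form of the norm matches the negative
  exponents applied to y in w.\<close>

lemma norm_U_inv:
  assumes "r \<in> carrier R"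
  shows "act_norm R \<phi> U r = (\<Oplus>\<^bsub>R\<^esub>i\<in>{..<2 ^ (n + 1) :: nat}. \<phi> (inv (\<sigma> [^] i)) r)"
proof -
  have U: "subgroup U G" by (simp add: generate_is_subgroup)
  have "(\<lambda>u. inv u) ` U = U"
  proof safe
    fix u assume u: "u \<in> U"
    then show "inv u \<in> U" by (rule subgroup.m_inv_closed[OF U])
    then show "u \<in> (\<lambda>u. inv u) ` U" using u U_subset by (metis imageI inv_inv subsetD)
  qed
  moreover have inj: "inj_on (\<lambda>u. inv u) U"
    using U_subset by (auto simp: inj_on_def)
  moreover have "(\<lambda>g. \<phi> g r) \<in> U \<rightarrow> carrier R"
    using assms U_subset by auto
  ultimately have "act_norm R \<phi> U r = (\<Oplus>\<^bsub>R\<^esub>u\<in>U. \<phi> (inv u) r)"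
    unfolding act_norm_def using finsum_reindex[OF _ inj, of "\<lambda>g. \<phi> g r"] by simp
  also have "\<dots> = (\<Oplus>\<^bsub>R\<^esub>i\<in>{..<2 ^ (n + 1) :: nat}. \<phi> (inv (\<sigma> [^] i)) r)"
    unfolding generate_sigma using assms by (intro finsum_reindex[OF _ inj_on_sigma_pow]) auto
  finally show ?thesis .
qed

text \<open>Norms start at exponent 0 but w starts at \<open>k = 1\<close>; the separated term is
  what the norm hypotheses are solved for.\<close>

lemma finsum_split_first:
  assumes "f \<in> {..<2 ^ (n + 1)} \<rightarrow> carrier R"
  shows "(\<Oplus>\<^bsub>R\<^esub>i\<in>{..<2 ^ (n + 1)}. f i) = f 0 \<oplus>\<^bsub>R\<^esub> (\<Oplus>\<^bsub>R\<^esub>i\<in>{1..2 ^ (n + 1) - 1 :: nat}. f i)"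
proof -
  have "{..<2 ^ (n + 1)} = insert 0 {1..2 ^ (n + 1) - 1 :: nat}"
    by auto
  then show ?thesis using assms by (simp add: Pi_iff)
qed

text \<open>Let z_k be the argument of the k-th partial norm. Telescoping leaves the sum of
  \<sigma>^k(z_k) - z_k over k. The first part is (1 - x)y by the norm of x, the second is x(-y) by
  the norm of y, and their difference is y.\<close>

lemma act_sigma_solution:
  assumes x: "x \<in> carrier R" and y: "y \<in> carrier R"
    and norm_x: "act_norm R \<phi> U x = \<one>\<^bsub>R\<^esub>" and norm_y: "act_norm R \<phi> U y = \<zero>\<^bsub>R\<^esub>"
  defines "w \<equiv> \<Oplus>\<^bsub>R\<^esub>k\<in>{1..2 ^ (n + 1) - 1}. partial_norm k (x \<otimes>\<^bsub>R\<^esub> \<phi> (inv (\<sigma> [^] k)) y)"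
  shows "\<phi> \<sigma> w = w \<oplus>\<^bsub>R\<^esub> y"
proof -
  let ?I = "{1..2 ^ (n + 1) - 1 :: nat}"
  let ?z = "\<lambda>k::nat. x \<otimes>\<^bsub>R\<^esub> \<phi> (inv (\<sigma> [^] k)) y"
  have z: "?z k \<in> carrier R" for k using x y by simp
  have P: "partial_norm k (?z k) \<in> carrier R" for k using z by (rule act_partial_sum_closed[OF sigma_closed])
  have w: "w \<in> carrier R" unfolding w_def using P by (intro finsum_closed) auto
  let ?p = "\<Oplus>\<^bsub>R\<^esub>k\<in>?I. \<phi> (inv (\<sigma> [^] k)) y" and ?q = "\<Oplus>\<^bsub>R\<^esub>k\<in>?I. \<phi> (\<sigma> [^] k) x"
  have p: "?p \<in> carrier R" and q: "?q \<in> carrier R" using x y by (auto intro!: finsum_closed)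
  \<comment> \<open>Dropping the exponent 0 from the two norms gives \<open>?p\<close> = -y and
    \<open>?q\<close> = 1 - x.\<close>
  have "act_norm R \<phi> U y = y \<oplus>\<^bsub>R\<^esub> ?p"
    unfolding norm_U_inv[OF y] by (subst finsum_split_first) (use y in \<open>auto simp: act_id\<close>)
  then have "y \<oplus>\<^bsub>R\<^esub> ?p = \<zero>\<^bsub>R\<^esub>" using norm_y by simp
  then have p_eq: "?p = \<ominus>\<^bsub>R\<^esub> y" using y p by (metis minus_equality a_comm)
  have "act_norm R \<phi> U x = x \<oplus>\<^bsub>R\<^esub> ?q"
    unfolding norm_U[OF x] by (subst finsum_split_first) (use x in \<open>auto simp: act_id\<close>)
  then have "x \<oplus>\<^bsub>R\<^esub> ?q = \<one>\<^bsub>R\<^esub>" using norm_x by simp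
  then have xq: "x \<otimes>\<^bsub>R\<^esub> y \<oplus>\<^bsub>R\<^esub> ?q \<otimes>\<^bsub>R\<^esub> y = y"
    using x y q by (metis l_distr l_one)
  \<comment> \<open>Here \<sigma>^k undoes the inverse power inside z_k, so y becomes a right factor
    independent of k and can be taken out of the sum without commutativity.\<close>
  have act_z: "\<phi> (\<sigma> [^] k) (?z k) = \<phi> (\<sigma> [^] k) x \<otimes>\<^bsub>R\<^esub> y" for k
    using x y by (simp add: act_mult act_act act_id)
  have "\<phi> \<sigma> w = (\<Oplus>\<^bsub>R\<^esub>k\<in>?I. \<phi> \<sigma> (partial_norm k (?z k)))"
    unfolding w_def using P by (intro act_finsum) auto
  then have "\<phi> \<sigma> w \<oplus>\<^bsub>R\<^esub> (\<Oplus>\<^bsub>R\<^esub>k\<in>?I. ?z k) = (\<Oplus>\<^bsub>R\<^esub>k\<in>?I. \<phi> \<sigma> (partial_norm k (?z k)) \<oplus>\<^bsub>R\<^esub> ?z k)"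
    using P z by (subst finsum_addf) auto
  also have "\<dots> = (\<Oplus>\<^bsub>R\<^esub>k\<in>?I. partial_norm k (?z k) \<oplus>\<^bsub>R\<^esub> \<phi> (\<sigma> [^] k) x \<otimes>\<^bsub>R\<^esub> y)"
    using P x y by (intro finsum_cong') (auto simp: act_partial_sum_telescope act_z)
  also have "\<dots> = w \<oplus>\<^bsub>R\<^esub> (\<Oplus>\<^bsub>R\<^esub>k\<in>?I. \<phi> (\<sigma> [^] k) x \<otimes>\<^bsub>R\<^esub> y)"
    unfolding w_def using P x y by (intro finsum_addf) auto
  also have "(\<Oplus>\<^bsub>R\<^esub>k\<in>?I. \<phi> (\<sigma> [^] k) x \<otimes>\<^bsub>R\<^esub> y) = ?q \<otimes>\<^bsub>R\<^esub> y"
    using x y by (intro finsum_ldistr[symmetric]) auto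
  also have "(\<Oplus>\<^bsub>R\<^esub>k\<in>?I. ?z k) = x \<otimes>\<^bsub>R\<^esub> ?p"
    using x y by (intro finsum_rdistr[symmetric]) auto
  finally have "\<phi> \<sigma> w \<oplus>\<^bsub>R\<^esub> \<ominus>\<^bsub>R\<^esub> (x \<otimes>\<^bsub>R\<^esub> y) = w \<oplus>\<^bsub>R\<^esub> ?q \<otimes>\<^bsub>R\<^esub> y"
    unfolding p_eq using x y by (simp only: r_minus)
  then have "\<phi> \<sigma> w = w \<oplus>\<^bsub>R\<^esub> ?q \<otimes>\<^bsub>R\<^esub> y \<oplus>\<^bsub>R\<^esub> x \<otimes>\<^bsub>R\<^esub> y"
    using x y w q by (metis act_closed add.inv_solve_right' sigma_closed m_closed add.m_closed minus_minus a_inv_closed)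
  also have "\<dots> = w \<oplus>\<^bsub>R\<^esub> (x \<otimes>\<^bsub>R\<^esub> y \<oplus>\<^bsub>R\<^esub> ?q \<otimes>\<^bsub>R\<^esub> y)"
    using x y w q by (simp add: a_ac)
  finally show ?thesis unfolding xq .
qed

lemma act_sigma_fixed_imp_U_fixed:
  assumes "r \<in> carrier R" "\<phi> \<sigma> r = r"
  shows "r \<in> fixed_points R \<phi> U"
proof -
  have "\<phi> (\<sigma> [^] i) r = r" for i :: nat
    by (induction i) (use assms in \<open>simp_all add: act_id flip: act_act\<close>)
  then show ?thesis using assms by (auto simp: fixed_points_def generate_sigma)
qed

section \<open>Invariance and relative norm of a\<close>

lemma sigma_tau_square: "\<sigma> \<otimes> \<tau> \<otimes> (\<sigma> \<otimes> \<tau>) = \<tau> \<otimes> \<tau>"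
  using sigma_int_pow_tau_mult(2)[of 1 1] tau_tau int_pow_int[of G \<sigma> "2 ^ n"] by simp

text \<open>As \<sigma>\<tau>\<sigma> = \<tau>, applying \<sigma>\<tau> to the equation for
  \<sigma>(w) relates \<sigma>\<tau>(w) to \<tau>(w).\<close>

lemma act_sigma_tau_sigma: "r \<in> carrier R \<Longrightarrow> \<phi> (\<sigma> \<otimes> \<tau>) (\<phi> \<sigma> r) = \<phi> \<tau> r"
  by (simp add: act_act G.m_assoc tau_sigma) (simp add: G.m_assoc[symmetric])

text \<open>The first summand involves \<sigma>^(-i)\<tau>, the second \<sigma>^(i+1)\<tau>, for 0
  \<le> i < 2^n. Modulo 2^(n+1) the exponents -i and i + 1 together meet every residue once, so the
  total is the norm of \<tau>(x).\<close>

lemma norm_tau_halves: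
  assumes x: "x \<in> carrier R"
  shows "\<phi> \<tau> (partial_norm (2 ^ n) x) \<oplus>\<^bsub>R\<^esub> partial_norm (2 ^ n) (\<phi> (\<sigma> \<otimes> \<tau>) x)
    = \<phi> \<tau> (act_norm R \<phi> U x)"
proof -
  let ?N = "2 ^ (n + 1) :: nat" and ?h = "2 ^ n :: nat"
  let ?f = "\<lambda>i::nat. \<phi> (\<sigma> [^] i) (\<phi> \<tau> x)"
  have f: "?f i \<in> carrier R" for i using x by simp
  have N: "?N = ?h + ?h" by simp
  \<comment> \<open>A common \<sigma> is split off from both halves to keep exponents natural: here
    N - 1 - i runs through the upper half of the range, and the other summand supplies the lower
    half.\<close>
  have "\<phi> \<tau> (partial_norm ?h x) = (\<Oplus>\<^bsub>R\<^esub>i\<in>{..<?h}. \<phi> \<sigma> (?f (?N - 1 - i)))"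
  proof -
    have "\<phi> \<tau> (\<phi> (\<sigma> [^] i) x) = \<phi> \<sigma> (?f (?N - 1 - i))" if "i < ?h" for i
    proof -
      have "i < ?N" using that N by linarith
      then have "\<tau> \<otimes> \<sigma> [^] i = \<sigma> \<otimes> \<sigma> [^] (?N - 1 - i) \<otimes> \<tau>"
        by (simp only: tau_sigma_pow inv_sigma_pow)
      then show ?thesis using x by (simp only: act_act act_closed G.m_closed G.nat_pow_closed sigma_closed tau_closed G.m_assoc)
    qed
    then show ?thesis using x by (subst act_finsum) (auto intro!: finsum_cong' simp del: power_Suc)
  qed
  also have "\<dots> = \<phi> \<sigma> (\<Oplus>\<^bsub>R\<^esub>i\<in>{..<?h}. ?f (?N - 1 - i))"
    using f by (subst act_finsum) auto
  also have "(\<Oplus>\<^bsub>R\<^esub>i\<in>{..<?h}. ?f (?N - 1 - i)) = (\<Oplus>\<^bsub>R\<^esub>i\<in>(\<lambda>i. ?N - 1 - i) ` {..<?h}. ?f i)"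
    using f by (intro finsum_reindex[symmetric]) (auto simp: inj_on_def)
  also have "(\<lambda>i. ?N - 1 - i) ` {..<?h} = {?h..<?N}"
  proof safe
    fix i assume "i \<in> {?h..<?N}"
    then have "i = ?N - 1 - (?N - 1 - i)" "?N - 1 - i < ?h" using N by auto
    then show "i \<in> (\<lambda>i. ?N - 1 - i) ` {..<?h}" by blast
  qed (use N in auto)
  finally have 1: "\<phi> \<tau> (partial_norm ?h x) = \<phi> \<sigma> (\<Oplus>\<^bsub>R\<^esub>i\<in>{?h..<?N}. ?f i)" .
  have "partial_norm ?h (\<phi> (\<sigma> \<otimes> \<tau>) x) = (\<Oplus>\<^bsub>R\<^esub>i\<in>{..<?h}. \<phi> \<sigma> (?f i))"
  proof -
    have "\<sigma> [^] i \<otimes> (\<sigma> \<otimes> \<tau>) = \<sigma> \<otimes> (\<sigma> [^] i \<otimes> \<tau>)" for i :: nat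
      by (metis G.m_assoc G.nat_pow_Suc G.nat_pow_Suc2 G.nat_pow_closed sigma_closed tau_closed)
    then show ?thesis using x by (intro finsum_cong') (auto simp: act_act)
  qed
  also have "\<dots> = \<phi> \<sigma> (\<Oplus>\<^bsub>R\<^esub>i\<in>{..<?h}. ?f i)"
    using f by (subst act_finsum) auto
  finally have 2: "partial_norm ?h (\<phi> (\<sigma> \<otimes> \<tau>) x) = \<phi> \<sigma> (\<Oplus>\<^bsub>R\<^esub>i\<in>{..<?h}. ?f i)" .
  have "\<phi> \<tau> (partial_norm ?h x) \<oplus>\<^bsub>R\<^esub> partial_norm ?h (\<phi> (\<sigma> \<otimes> \<tau>) x)
      = \<phi> \<sigma> ((\<Oplus>\<^bsub>R\<^esub>i\<in>{?h..<?N}. ?f i) \<oplus>\<^bsub>R\<^esub> (\<Oplus>\<^bsub>R\<^esub>i\<in>{..<?h}. ?f i))"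
    unfolding 1 2 using f by (intro act_add[symmetric]) (auto intro!: finsum_closed)
  also have "(\<Oplus>\<^bsub>R\<^esub>i\<in>{?h..<?N}. ?f i) \<oplus>\<^bsub>R\<^esub> (\<Oplus>\<^bsub>R\<^esub>i\<in>{..<?h}. ?f i) = (\<Oplus>\<^bsub>R\<^esub>i\<in>{?h..<?N} \<union> {..<?h}. ?f i)"
    using f by (intro finsum_Un_disjoint[symmetric]) auto
  also have "{?h..<?N} \<union> {..<?h} = {..<?N}" by auto
  also have "partial_norm ?N (\<phi> \<tau> x) = act_norm R \<phi> U (\<phi> \<tau> x)"
    using x by (simp only: norm_U act_closed tau_closed)
  \<comment> \<open>The split-off \<sigma> is absorbed, since a norm over \<open>U\<close> is fixed
    by \<sigma>; normality of \<open>U\<close> moves \<tau> outside.\<close>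
  also have "\<phi> \<sigma> \<dots> = \<phi> \<tau> (act_norm R \<phi> U x)"
    using x act_sigma_norm_U[of "\<phi> \<tau> x"] by (simp add: act_norm_normal[OF normal_generate_sigma])
  finally show ?thesis .
qed

text \<open>
  With \<open>y = (1 - \<sigma>\<tau>)(x)\<close>, invariance under \<open>\<sigma>\<close> comes from
  \<open>(\<sigma> - 1)(1 - \<tau>) = (1 + \<sigma>\<tau>)(\<sigma> - 1)\<close> and \<open>(1 + \<sigma>\<tau>)y = (1 - \<sigma>\<^sup>h)(x)\<close>, where \<open>h = 2\<^sup>n\<close>.
\<close>

lemma quaternion_norm_one_element:
  assumes x: "x \<in> carrier R" and w: "w \<in> carrier R" and norm_x: "act_norm R \<phi> U x = \<one>\<^bsub>R\<^esub>"
    and s_w: "\<phi> \<sigma> w = w \<oplus>\<^bsub>R\<^esub> (x \<ominus>\<^bsub>R\<^esub> \<phi> (\<sigma> \<otimes> \<tau>) x)"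
  defines "a \<equiv> partial_norm (2 ^ n) x \<oplus>\<^bsub>R\<^esub> (w \<ominus>\<^bsub>R\<^esub> \<phi> \<tau> w)"
  shows "\<phi> \<sigma> a = a" and "a \<oplus>\<^bsub>R\<^esub> \<phi> \<tau> a = \<one>\<^bsub>R\<^esub>"
proof -
  let ?S = "partial_norm (2 ^ n)" and ?h = "\<sigma> [^] (2 ^ n :: nat)" and ?st = "\<sigma> \<otimes> \<tau>"
  have S [simp]: "r \<in> carrier R \<Longrightarrow> ?S r \<in> carrier R" for r
    by (rule act_partial_sum_closed[OF sigma_closed])
  have tel: "\<phi> \<sigma> (?S r) = ?S r \<oplus>\<^bsub>R\<^esub> \<phi> ?h r \<ominus>\<^bsub>R\<^esub> r" if r: "r \<in> carrier R" for r
  proof -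
    have "\<phi> \<sigma> (?S r) = \<phi> \<sigma> (?S r) \<oplus>\<^bsub>R\<^esub> r \<ominus>\<^bsub>R\<^esub> r"
      using r by (simp add: a_minus_def a_assoc r_neg)
    then show ?thesis using r by (simp only: act_partial_sum_telescope[OF sigma_closed r])
  qed
  have S_add: "?S (r \<oplus>\<^bsub>R\<^esub> s) = ?S r \<oplus>\<^bsub>R\<^esub> ?S s" if "r \<in> carrier R" "s \<in> carrier R" for r s
    using that by (subst finsum_addf[symmetric]) (auto intro!: finsum_cong' simp: act_add)
  have S_minus: "?S (r \<ominus>\<^bsub>R\<^esub> s) = ?S r \<ominus>\<^bsub>R\<^esub> ?S s" if "r \<in> carrier R" "s \<in> carrier R" for r s
  proof -
    have "?S r = ?S (r \<ominus>\<^bsub>R\<^esub> s) \<oplus>\<^bsub>R\<^esub> ?S s"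
      using that by (simp add: minus_add_cancel flip: S_add)
    then show ?thesis using that by (simp add: a_minus_def a_assoc r_neg)
  qed
  \<comment> \<open>The only unknown in \<sigma>(a) is \<sigma>\<tau>(w); evaluating this expression
    in two ways expresses it through \<tau>(w) and x.\<close>
  have "\<phi> ?st (\<phi> \<sigma> w) = \<phi> ?st w \<oplus>\<^bsub>R\<^esub> (\<phi> ?st x \<ominus>\<^bsub>R\<^esub> \<phi> ?st (\<phi> ?st x))"
    using x w by (simp add: s_w act_add act_minus)
  also have "\<phi> ?st (\<phi> ?st x) = \<phi> ?h x"
    using x by (simp add: act_act sigma_tau_square tau_tau)
  finally have "\<phi> \<tau> w = \<phi> ?st w \<oplus>\<^bsub>R\<^esub> (\<phi> ?st x \<ominus>\<^bsub>R\<^esub> \<phi> ?h x)"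
    using w by (simp add: act_sigma_tau_sigma)
  then have t_w: "\<phi> ?st w = \<phi> \<tau> w \<ominus>\<^bsub>R\<^esub> (\<phi> ?st x \<ominus>\<^bsub>R\<^esub> \<phi> ?h x)"
    using x w by (simp add: a_minus_def a_assoc r_neg)
  have "\<phi> \<sigma> a = ?S x \<oplus>\<^bsub>R\<^esub> \<phi> ?h x \<ominus>\<^bsub>R\<^esub> x \<oplus>\<^bsub>R\<^esub>
      (w \<oplus>\<^bsub>R\<^esub> (x \<ominus>\<^bsub>R\<^esub> \<phi> ?st x) \<ominus>\<^bsub>R\<^esub> (\<phi> \<tau> w \<ominus>\<^bsub>R\<^esub> (\<phi> ?st x \<ominus>\<^bsub>R\<^esub> \<phi> ?h x)))"
    unfolding a_def using x w by (simp add: act_add act_minus s_w tel act_act t_w)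
  also have "\<dots> = a"
    unfolding a_def
    using x w by (intro linear_cancel) simp_all
  finally show "\<phi> \<sigma> a = a" .

  \<comment> \<open>Since \<tau>^2 = \<sigma>^(2^n), computing \<tau>(a) requires \<sigma>^(2^n)(w).
    Telescoping gives its difference from w as (\<sigma> - 1)S(w) = S((\<sigma> - 1)(w)), which is
    known.\<close>
  have "\<phi> \<sigma> (?S w) = ?S (\<phi> \<sigma> w)"
  proof -
    have "\<sigma> \<otimes> \<sigma> [^] i = \<sigma> [^] i \<otimes> \<sigma>" for i :: nat
      by (metis G.nat_pow_Suc G.nat_pow_Suc2 sigma_closed)
    then show ?thesis using w by (subst act_finsum) (auto intro!: finsum_cong' simp: act_act)
  qed
  also have "\<dots> = ?S w \<oplus>\<^bsub>R\<^esub> (?S x \<ominus>\<^bsub>R\<^esub> ?S (\<phi> ?st x))"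
    unfolding s_w using x w by (simp add: S_add S_minus)
  finally have "?S w \<oplus>\<^bsub>R\<^esub> (?S x \<ominus>\<^bsub>R\<^esub> ?S (\<phi> ?st x)) \<oplus>\<^bsub>R\<^esub> w = ?S w \<oplus>\<^bsub>R\<^esub> \<phi> ?h w"
    using act_partial_sum_telescope[OF sigma_closed w, of "2 ^ n"] by simp
  then have h_w: "\<phi> ?h w = ?S x \<ominus>\<^bsub>R\<^esub> ?S (\<phi> ?st x) \<oplus>\<^bsub>R\<^esub> w"
    using x w by (simp add: a_assoc)
  have "\<phi> \<tau> a = \<phi> \<tau> (?S x) \<oplus>\<^bsub>R\<^esub> (\<phi> \<tau> w \<ominus>\<^bsub>R\<^esub> \<phi> ?h w)"
    unfolding a_def using x w by (simp add: act_add act_minus act_act tau_tau)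
  then have "a \<oplus>\<^bsub>R\<^esub> \<phi> \<tau> a = ?S x \<oplus>\<^bsub>R\<^esub> (w \<ominus>\<^bsub>R\<^esub> \<phi> \<tau> w) \<oplus>\<^bsub>R\<^esub>
      (\<phi> \<tau> (?S x) \<oplus>\<^bsub>R\<^esub> (\<phi> \<tau> w \<ominus>\<^bsub>R\<^esub> (?S x \<ominus>\<^bsub>R\<^esub> ?S (\<phi> ?st x) \<oplus>\<^bsub>R\<^esub> w)))"
    unfolding h_w by (simp add: a_def)
  also have "\<dots> = \<phi> \<tau> (?S x) \<oplus>\<^bsub>R\<^esub> ?S (\<phi> ?st x)"
    using x w by (intro linear_cancel') simp_all
  also have "\<dots> = \<one>\<^bsub>R\<^esub>"
    by (simp add: norm_tau_halves x norm_x act_one)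
  finally show "a \<oplus>\<^bsub>R\<^esub> \<phi> \<tau> a = \<one>\<^bsub>R\<^esub>" .
qed

section \<open>Norms over G and over G/U\<close>

text \<open>Over \<open>U\<close> the fixed factor \<open>a\<close> comes out on the left. The coset
  U\<tau> contributes the norm over \<open>U\<close> of \<tau>(ax), and normality turns this into
  \<tau> of the norm already computed.\<close>

lemma norm_G_mult:
  assumes x: "x \<in> carrier R" and norm_x: "act_norm R \<phi> U x = \<one>\<^bsub>R\<^esub>"
    and a: "a \<in> fixed_points R \<phi> U"
  shows "act_norm R \<phi> (carrier G) (a \<otimes>\<^bsub>R\<^esub> x) = a \<oplus>\<^bsub>R\<^esub> \<phi> \<tau> a"
proof -
  have aR: "a \<in> carrier R" and fixed: "\<And>u. u \<in> U \<Longrightarrow> \<phi> u a = a"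
    using a by (auto simp: fixed_points_def)
  have ax: "a \<otimes>\<^bsub>R\<^esub> x \<in> carrier R" using aR x by simp
  have "act_norm R \<phi> U (a \<otimes>\<^bsub>R\<^esub> x) = (\<Oplus>\<^bsub>R\<^esub>u\<in>U. a \<otimes>\<^bsub>R\<^esub> \<phi> u x)"
    unfolding act_norm_def using aR x U_subset fixed
    by (intro finsum_cong') (auto simp: act_mult subset_iff)
  also have "\<dots> = a \<otimes>\<^bsub>R\<^esub> act_norm R \<phi> U x"
    unfolding act_norm_def using aR x U_subset finite_subset[OF U_subset finite_carrier]
    by (intro finsum_rdistr[symmetric]) auto
  finally have N: "act_norm R \<phi> U (a \<otimes>\<^bsub>R\<^esub> x) = a" using norm_x aR by simp
  have carrier: "carrier G = U \<union> (\<lambda>u. u \<otimes> \<tau>) ` U" and disj: "U \<inter> (\<lambda>u. u \<otimes> \<tau>) ` U = {}"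
    using carrier_eq sigma_tau_cosets_disjoint by (simp_all only: generate_sigma image_image)
  have inj: "inj_on (\<lambda>u. u \<otimes> \<tau>) U"
    using U_subset by (auto intro!: inj_onI simp: subset_iff)
  have "act_norm R \<phi> (carrier G) (a \<otimes>\<^bsub>R\<^esub> x) = act_norm R \<phi> U (a \<otimes>\<^bsub>R\<^esub> x) \<oplus>\<^bsub>R\<^esub>
      (\<Oplus>\<^bsub>R\<^esub>g\<in>(\<lambda>u. u \<otimes> \<tau>) ` U. \<phi> g (a \<otimes>\<^bsub>R\<^esub> x))"
    unfolding act_norm_def carrier using U_subset finite_subset[OF U_subset finite_carrier] ax
    by (intro finsum_Un_disjoint disj) auto
  also have "(\<Oplus>\<^bsub>R\<^esub>g\<in>(\<lambda>u. u \<otimes> \<tau>) ` U. \<phi> g (a \<otimes>\<^bsub>R\<^esub> x)) = (\<Oplus>\<^bsub>R\<^esub>u\<in>U. \<phi> (u \<otimes> \<tau>) (a \<otimes>\<^bsub>R\<^esub> x))"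
    using U_subset ax by (intro finsum_reindex inj) auto
  also have "\<dots> = act_norm R \<phi> U (\<phi> \<tau> (a \<otimes>\<^bsub>R\<^esub> x))"
    unfolding act_norm_def using U_subset ax by (intro finsum_cong') (auto simp: act_act subset_iff)
  also have "\<dots> = \<phi> \<tau> a"
    using ax by (simp add: act_norm_normal[OF normal_generate_sigma] N)
  finally show ?thesis unfolding N .
qed

text \<open>The cosets of 1 and \<tau> exhaust the quotient. They must also be shown distinct, since
  the norm is a sum over a set and would otherwise have a single term.\<close>

lemma norm_G_Mod_U:
  assumes a: "a \<in> fixed_points R \<phi> U"
  shows "act_norm R (quotient_act \<phi>) (carrier (G Mod U)) a = a \<oplus>\<^bsub>R\<^esub> \<phi> \<tau> a"
proof -
  interpret U: normal U G by (rule normal_generate_sigma)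
  have aR: "a \<in> carrier R" using a by (simp add: fixed_points_def)
  have carrier: "carrier G = U \<union> (\<lambda>u. u \<otimes> \<tau>) ` U"
    using carrier_eq by (simp only: generate_sigma image_image)
  have U_coset: "U #> u = U" if "u \<in> U" for u
    using that by (simp add: coset_join2 U.subgroup_axioms U.mem_carrier)
  have "U #> (u \<otimes> \<tau>) = U #> \<tau>" if "u \<in> U" for u
    using that U_coset by (metis coset_mult_assoc U.subset U.mem_carrier tau_closed)
  then have "U #> g \<in> {U #> \<one>, U #> \<tau>}" if "g \<in> carrier G" for g
    using that U_coset U_coset[OF U.one_closed] unfolding carrier by blast
  then have "(\<lambda>g. U #> g) ` carrier G = {U #> \<one>, U #> \<tau>}"
    using G.one_closed tau_closed by blast
  then have "carrier (G Mod U) = {U #> \<one>, U #> \<tau>}"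
    by (simp add: carrier_FactGroup)
  moreover have "U #> \<one> \<noteq> U #> \<tau>"
    using tau_notin rcos_self[OF tau_closed U.subgroup_axioms] U_coset[OF U.one_closed] by auto
  ultimately show ?thesis
    using aR by (simp add: act_norm_def quotient_act_coset[OF normal_generate_sigma _ a] act_id)
qed

section \<open>From group ring notation to explicit sums, and the theorem\<close>

lemma group_ring_act_partial_norm:
  assumes "r \<in> carrier R"
  shows "group_ring_act R \<phi> (\<Sum>i<k. frag_of (\<sigma> [^] i)) r = partial_norm k r"
  using assms by (subst group_ring_act_sum) (auto simp: group_ring_act_frag_of intro!: finsum_cong')

lemma group_ring_act_frag_of_frag_of:
  assumes "g \<in> carrier G" "h \<in> carrier G" "r \<in> carrier R"
  shows "group_ring_act R \<phi> (frag_of g - frag_of h) r = \<phi> g r \<ominus>\<^bsub>R\<^esub> \<phi> h r"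
    and "group_ring_act R \<phi> (frag_of g + frag_of h) r = \<phi> g r \<oplus>\<^bsub>R\<^esub> \<phi> h r"
  using assms by (simp_all add: group_ring_act_minus group_ring_act_add group_ring_act_frag_of)

end

theorem mainTheorem3:
  fixes G :: "('g, 'm) monoid_scheme" and R :: "('r, 'k) ring_scheme"
    and \<phi> :: "'g \<Rightarrow> 'r \<Rightarrow> 'r" and \<sigma> \<tau> :: 'g and U :: "'g set"
    and n :: nat and x w a :: 'r
  assumes n: "n \<ge> 1"
    and G: "generalized_quaternion G n \<sigma> \<tau>"
    and action: "ring_action G R \<phi>"
    and U: "U = generate G {\<sigma>}"
    and x: "x \<in> carrier R"
    and norm_x: "act_norm R \<phi> U x = \<one>\<^bsub>R\<^esub>"
    and w: "w = (\<Oplus>\<^bsub>R\<^esub>k\<in>{1..2 ^ (n + 1) - 1}.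
              group_ring_act R \<phi> (\<Sum>i<k. frag_of (\<sigma> [^]\<^bsub>G\<^esub> i))
                (x \<otimes>\<^bsub>R\<^esub> \<phi> (\<sigma> [^]\<^bsub>G\<^esub> (- int k))
                   (group_ring_act R \<phi> (frag_of \<one>\<^bsub>G\<^esub> - frag_of (\<sigma> \<otimes>\<^bsub>G\<^esub> \<tau>)) x)))"
    and a: "a = group_ring_act R \<phi> (\<Sum>i<(2::nat) ^ n. frag_of (\<sigma> [^]\<^bsub>G\<^esub> i)) x \<oplus>\<^bsub>R\<^esub>
                group_ring_act R \<phi> (frag_of \<one>\<^bsub>G\<^esub> - frag_of \<tau>) w"
  shows "a \<in> fixed_points R \<phi> U \<and>
    act_norm R (quotient_act \<phi>) (carrier (G Mod U)) a =
      group_ring_act R \<phi> (frag_of \<one>\<^bsub>G\<^esub> + frag_of \<tau>) a \<and>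
    group_ring_act R \<phi> (frag_of \<one>\<^bsub>G\<^esub> + frag_of \<tau>) a = \<one>\<^bsub>R\<^esub> \<and>
    act_norm R \<phi> (carrier G) (a \<otimes>\<^bsub>R\<^esub> x) = \<one>\<^bsub>R\<^esub>"
proof -
  have "group G" using G by (simp add: generalized_quaternion_def)
  then interpret quaternion_ring_action G n \<sigma> \<tau> R \<phi>
    using G action
    by (simp add: quaternion_ring_action_def generalized_quaternion_group_def
        generalized_quaternion_group_axioms_def)
  note norm_x = norm_x[unfolded U]
  define y where "y = x \<ominus>\<^bsub>R\<^esub> \<phi> (\<sigma> \<otimes>\<^bsub>G\<^esub> \<tau>) x"
  have y: "y \<in> carrier R" unfolding y_def using x by simp
  \<comment> \<open>By normality the norm over \<open>U\<close> commutes with \<sigma>\<tau>, and a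
    ring automorphism fixes 1, so the two contributions to the norm of y are equal.\<close>
  have "act_norm R \<phi> (generate G {\<sigma>}) y = \<one>\<^bsub>R\<^esub> \<ominus>\<^bsub>R\<^esub> \<phi> (\<sigma> \<otimes>\<^bsub>G\<^esub> \<tau>) \<one>\<^bsub>R\<^esub>"
    unfolding y_def using x U_subset
    by (simp add: act_norm_minus act_norm_normal[OF normal_generate_sigma] norm_x)
  then have norm_y: "act_norm R \<phi> (generate G {\<sigma>}) y = \<zero>\<^bsub>R\<^esub>"
    by (simp add: act_one a_minus_def r_neg)
  have w_eq: "w = (\<Oplus>\<^bsub>R\<^esub>k\<in>{1..2 ^ (n + 1) - 1 :: nat}.
      \<Oplus>\<^bsub>R\<^esub>i\<in>{..<k}. \<phi> (\<sigma> [^]\<^bsub>G\<^esub> i) (x \<otimes>\<^bsub>R\<^esub> \<phi> (inv\<^bsub>G\<^esub> (\<sigma> [^]\<^bsub>G\<^esub> k)) y))"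
    unfolding w using x y
    by (simp only: group_ring_act_frag_of_frag_of group_ring_act_partial_norm act_id y_def[symmetric]
        G.int_pow_neg_int G.one_closed G.m_closed sigma_closed tau_closed R.m_closed act_closed
        G.inv_closed G.nat_pow_closed)
  have s_w: "\<phi> \<sigma> w = w \<oplus>\<^bsub>R\<^esub> (x \<ominus>\<^bsub>R\<^esub> \<phi> (\<sigma> \<otimes>\<^bsub>G\<^esub> \<tau>) x)"
    unfolding w_eq y_def[symmetric] by (rule act_sigma_solution[OF x y norm_x norm_y])
  have wR: "w \<in> carrier R"
    unfolding w_eq using x y by (intro finsum_closed funcsetI act_partial_sum_closed) auto
  have a_eq: "a = (\<Oplus>\<^bsub>R\<^esub>i\<in>{..<2 ^ n :: nat}. \<phi> (\<sigma> [^]\<^bsub>G\<^esub> i) x) \<oplus>\<^bsub>R\<^esub> (w \<ominus>\<^bsub>R\<^esub> \<phi> \<tau> w)"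
    unfolding a using x wR by (simp add: group_ring_act_partial_norm group_ring_act_frag_of_frag_of act_id)
  have aR: "a \<in> carrier R"
    unfolding a_eq using x wR by (simp add: act_partial_sum_closed)
  have fixed: "a \<in> fixed_points R \<phi> (generate G {\<sigma>})"
    using aR quaternion_norm_one_element(1)[OF x wR norm_x s_w] unfolding a_eq by (rule act_sigma_fixed_imp_U_fixed)
  have one_t: "a \<oplus>\<^bsub>R\<^esub> \<phi> \<tau> a = \<one>\<^bsub>R\<^esub>"
    unfolding a_eq by (rule quaternion_norm_one_element(2)[OF x wR norm_x s_w])
  then show ?thesis
    unfolding U using fixed aR
    by (simp add: norm_G_Mod_U norm_G_mult[OF x norm_x] group_ring_act_frag_of_frag_of act_id)
qed

end
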